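(* Let $\delta$ be a locally nilpotent $k$-derivation of $B_{d,P}$ and let $\alpha\in\mathrm{Aut}(B_{d,P})$. Then the following are equivalent. (i) $\alpha\in\mathrm{Aut}(\delta)$. (ii) $\delta\alpha(y_1)=\alpha\delta(y_1)$. (iii) $\delta\alpha(y_2)=\alpha\delta(y_2)$.
   Context: $k$ is a field of characteristic zero. For a $k$-algebra $B$, $\mathrm{Aut}(B)$ is the group of $k$-algebra automorphisms of $B$; a locally nilpotent derivation is a $k$-derivation $\delta$ of $B$ such that every $b\in B$ is killed by some power of $\delta$; and $\mathrm{Aut}(\delta)=\{\sigma\in\mathrm{Aut}(B):\sigma\delta=\delta\sigma\}$. $B_{d,P}$ is a generalised Danielewski surface in standard form: $d\geqslant 2$, $r\geqslant 2$, $P(X,Y_1)=\prod_{i=1}^{r}(Y_1-\sigma_i(X))$ with $\sigma_i(X)\in k[X]$, and $B_{d,P}=k[X,Y_1,Y_2]/(X^dY_2-P(X,Y_1))$; $x,y_1,y_2$ are the images of $X,Y_1,Y_2$. *)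

theory Defs
  imports "HOL-Algebra.Algebra" "HOL-Algebra.Algebraic_Closure_Type"
    "HOL-Computational_Algebra.Polynomial"
begin

section \<open>Automorphisms and locally nilpotent derivations of a \<open>k\<close>-algebra\<close>

text \<open>
  The field \<open>k\<close> is a type, so an algebra \<open>B\<close> is a module record whose scalars range over all
  of that type. As usual in HOL-Algebra, maps on \<open>B\<close> are only meaningful on the carrier, and
  equality of maps is therefore equality at all elements of the carrier.
\<close>

definition alg_aut :: "('k, 'b, 'm) module_scheme \<Rightarrow> ('b \<Rightarrow> 'b) set" where
  "alg_aut B = {\<alpha> \<in> ring_iso B B. \<forall>c. \<forall>b \<in> carrier B. \<alpha> (c \<odot>\<^bsub>B\<^esub> b) = c \<odot>\<^bsub>B\<^esub> \<alpha> b}"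

definition alg_der :: "('k, 'b, 'm) module_scheme \<Rightarrow> ('b \<Rightarrow> 'b) set" where
  "alg_der B = {\<delta> \<in> carrier B \<rightarrow> carrier B.
     (\<forall>a \<in> carrier B. \<forall>b \<in> carrier B. \<delta> (a \<oplus>\<^bsub>B\<^esub> b) = \<delta> a \<oplus>\<^bsub>B\<^esub> \<delta> b) \<and>
     (\<forall>c. \<forall>b \<in> carrier B. \<delta> (c \<odot>\<^bsub>B\<^esub> b) = c \<odot>\<^bsub>B\<^esub> \<delta> b) \<and>
     (\<forall>a \<in> carrier B. \<forall>b \<in> carrier B.
        \<delta> (a \<otimes>\<^bsub>B\<^esub> b) = (\<delta> a \<otimes>\<^bsub>B\<^esub> b) \<oplus>\<^bsub>B\<^esub> (a \<otimes>\<^bsub>B\<^esub> \<delta> b))}"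

definition lnd :: "('k, 'b, 'm) module_scheme \<Rightarrow> ('b \<Rightarrow> 'b) set" where
  "lnd B = {\<delta> \<in> alg_der B. \<forall>b \<in> carrier B. \<exists>n. (\<delta> ^^ n) b = \<zero>\<^bsub>B\<^esub>}"

definition der_aut :: "('k, 'b, 'm) module_scheme \<Rightarrow> ('b \<Rightarrow> 'b) \<Rightarrow> ('b \<Rightarrow> 'b) set" where
  "der_aut B \<delta> = {\<sigma> \<in> alg_aut B. \<forall>b \<in> carrier B. \<sigma> (\<delta> b) = \<delta> (\<sigma> b)}"


section \<open>Generalised Danielewski surfaces\<close>

text \<open>
  \<open>k[X, Y\<^sub>1, Y\<^sub>2]\<close> is the iterated polynomial ring \<open>k[X][Y\<^sub>1][Y\<^sub>2]\<close>, whose elements have type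
  \<open>'k poly poly poly\<close>: the outermost variable is \<open>Y\<^sub>2\<close>, the innermost one is \<open>X\<close>. Likewise
  \<open>k[X, Y\<^sub>1]\<close> is \<open>'k poly poly\<close>, embedded as the polynomials that are constant in \<open>Y\<^sub>2\<close>.
\<close>

definition var_X :: "'k::comm_ring_1 poly poly poly" where
  "var_X = [:[:[:0, 1:]:]:]"

definition var_Y1 :: "'k::comm_ring_1 poly poly poly" where
  "var_Y1 = [:[:0, 1:]:]"

definition var_Y2 :: "'k::comm_ring_1 poly poly poly" where
  "var_Y2 = [:0, 1:]"

abbreviation poly_ring3 :: "'k::comm_ring_1 poly poly poly ring" where
  "poly_ring3 \<equiv> ring_of_type_algebra"

definition dan_ideal :: "nat \<Rightarrow> 'k::comm_ring_1 poly poly \<Rightarrow> 'k poly poly poly set" where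
  "dan_ideal d P = PIdl\<^bsub>poly_ring3\<^esub> (var_X ^ d * var_Y2 - [:P:])"

definition dan_class ::
  "nat \<Rightarrow> 'k::comm_ring_1 poly poly \<Rightarrow> 'k poly poly poly \<Rightarrow> 'k poly poly poly set" where
  "dan_class d P f = dan_ideal d P +>\<^bsub>poly_ring3\<^esub> f"

definition dan_alg ::
  "nat \<Rightarrow> 'k::comm_ring_1 poly poly \<Rightarrow> ('k, 'k poly poly poly set) module" where
  "dan_alg d P = ring.extend (poly_ring3 Quot dan_ideal d P)
     (module.fields (\<lambda>c b. dan_class d P [:[:[:c:]:]:] \<otimes>\<^bsub>poly_ring3 Quot dan_ideal d P\<^esub> b))"

definition dan_x :: "nat \<Rightarrow> 'k::comm_ring_1 poly poly \<Rightarrow> 'k poly poly poly set" where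
  "dan_x d P = dan_class d P var_X"

definition dan_y1 :: "nat \<Rightarrow> 'k::comm_ring_1 poly poly \<Rightarrow> 'k poly poly poly set" where
  "dan_y1 d P = dan_class d P var_Y1"

definition dan_y2 :: "nat \<Rightarrow> 'k::comm_ring_1 poly poly \<Rightarrow> 'k poly poly poly set" where
  "dan_y2 d P = dan_class d P var_Y2"

definition std_poly :: "nat \<Rightarrow> (nat \<Rightarrow> 'k::comm_ring_1 poly) \<Rightarrow> 'k poly poly" where
  "std_poly r s = (\<Prod>i = 1..r. [:- s i, 1:])"

lemma cring_poly_ring3: "cring (poly_ring3 :: 'k::comm_ring_1 poly poly poly ring)"
  by (rule cring_from_type_algebra)

lemma ideal_dan_ideal: "ideal (dan_ideal d P) poly_ring3"
  unfolding dan_ideal_def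
  by (rule cring.cgenideal_ideal[OF cring_poly_ring3]) (simp add: ring_of_type_algebra_def)

lemma dan_alg_sel:
  "carrier (dan_alg d P) = carrier (poly_ring3 Quot dan_ideal d P)"
  "monoid.mult (dan_alg d P) = monoid.mult (poly_ring3 Quot dan_ideal d P)"
  "\<one>\<^bsub>dan_alg d P\<^esub> = \<one>\<^bsub>poly_ring3 Quot dan_ideal d P\<^esub>"
  "\<zero>\<^bsub>dan_alg d P\<^esub> = \<zero>\<^bsub>poly_ring3 Quot dan_ideal d P\<^esub>"
  "add (dan_alg d P) = add (poly_ring3 Quot dan_ideal d P)"
  "c \<odot>\<^bsub>dan_alg d P\<^esub> b = dan_class d P [:[:[:c:]:]:] \<otimes>\<^bsub>dan_alg d P\<^esub> b"
  by (simp_all add: dan_alg_def ring.extend_def module.fields_def)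

lemma dan_class_hom: "dan_class d P \<in> ring_hom poly_ring3 (dan_alg d P)"
proof -
  have "dan_class d P = (+>\<^bsub>poly_ring3\<^esub>) (dan_ideal d P)"
    by (simp add: fun_eq_iff dan_class_def)
  with ideal.rcos_ring_hom[OF ideal_dan_ideal[of d P]] show ?thesis
    by (simp add: ring_hom_def dan_alg_sel)
qed

lemma cring_dan_alg: "cring (dan_alg d P)"
proof -
  interpret Q: cring "poly_ring3 Quot dan_ideal d P"
    by (rule ideal.quotient_is_cring[OF ideal_dan_ideal cring_poly_ring3])
  show ?thesis
  proof (rule cringI)
    show "abelian_group (dan_alg d P)"
    proof (rule abelian_groupI)
      fix a assume "a \<in> carrier (dan_alg d P)"
      then show "\<exists>b \<in> carrier (dan_alg d P). b \<oplus>\<^bsub>dan_alg d P\<^esub> a = \<zero>\<^bsub>dan_alg d P\<^esub>"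
        unfolding dan_alg_sel by (meson Q.a_inv_closed Q.l_neg)
    qed (simp_all only: dan_alg_sel Q.a_closed Q.zero_closed Q.a_ac Q.l_zero Q.r_zero)
    show "comm_monoid (dan_alg d P)"
      by (rule comm_monoidI)
        (simp_all only: dan_alg_sel Q.m_closed Q.one_closed Q.m_ac Q.l_one Q.r_one)
  qed (simp only: dan_alg_sel Q.l_distr)
qed

lemma algebra_dan_alg:
  "algebra (ring_of_type_algebra :: 'k::comm_ring_1 ring) (dan_alg d (P :: 'k poly poly))"
proof -
  interpret B: cring "dan_alg d P" by (rule cring_dan_alg)
  note hom = dan_class_hom[of d P, unfolded ring_hom_def ring_of_type_algebra_def, simplified]
  have hc: "dan_class d P f \<in> carrier (dan_alg d P)" for f using hom by auto
  have ha: "dan_class d P (f + g) = dan_class d P f \<oplus>\<^bsub>dan_alg d P\<^esub> dan_class d P g" for f g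
    using hom by auto
  have hm: "dan_class d P (f * g) = dan_class d P f \<otimes>\<^bsub>dan_alg d P\<^esub> dan_class d P g" for f g
    using hom by auto
  have h1: "dan_class d P [:[:[:1:]:]:] = \<one>\<^bsub>dan_alg d P\<^esub>"
    using hom by (auto simp flip: one_pCons)
  have A: "[:[:[:a + b:]:]:] = [:[:[:a:]:]:] + [:[:[:b:]:]:]"
    and M: "[:[:[:a * b:]:]:] = [:[:[:a:]:]:] * [:[:[:b:]:]:]" for a b :: 'k
    by simp_all
  show ?thesis
  proof (rule algebraI)
    show "cring (ring_of_type_algebra :: 'k ring)" by (rule cring_from_type_algebra)
  qed (simp_all add: dan_alg_sel(6) ring_of_type_algebra_def A M ha hm hc h1 cring_dan_alg
        B.l_distr B.r_distr B.m_assoc del: add_pCons mult_pCons_left mult_pCons_right)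
qed

lemma dan_class_eq_iff: "dan_class d P f = dan_class d P g \<longleftrightarrow>
    (var_X ^ d * var_Y2 - [:P:]) dvd (f - g)"
proof -
  interpret I: ideal "dan_ideal d P" poly_ring3 by (rule ideal_dan_ideal)
  have neg: "\<ominus>\<^bsub>poly_ring3\<^esub> h = - h" for h :: "'a poly poly poly"
    using I.minus_equality[of "- h" h] by (simp add: ring_of_type_algebra_def)
  have "dan_class d P f = dan_class d P g \<longleftrightarrow> f \<ominus>\<^bsub>poly_ring3\<^esub> g \<in> dan_ideal d P"
    unfolding dan_class_def
    by (rule I.quotient_eq_iff_same_a_r_cos[symmetric, OF ideal_dan_ideal])
      (simp_all add: ring_of_type_algebra_def)
  also have "f \<ominus>\<^bsub>poly_ring3\<^esub> g = f - g"
    by (simp add: a_minus_def neg) (simp add: ring_of_type_algebra_def)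
  finally show ?thesis
    by (auto simp: dan_ideal_def cgenideal_def ring_of_type_algebra_def dvd_def mult.commute)
qed

lemma dan_relation:
  "dan_x d P [^]\<^bsub>dan_alg d P\<^esub> d \<otimes>\<^bsub>dan_alg d P\<^esub> dan_y2 d P = dan_class d P [:P:]"
proof -
  interpret B: cring "dan_alg d P" by (rule cring_dan_alg)
  note hom = dan_class_hom[of d P, unfolded ring_hom_def ring_of_type_algebra_def, simplified]
  have pow: "dan_class d P (f ^ n) = dan_class d P f [^]\<^bsub>dan_alg d P\<^esub> n" for f n
    using hom by (induction n) (simp_all add: power_Suc2 del: power_Suc)
  have "dan_x d P [^]\<^bsub>dan_alg d P\<^esub> d \<otimes>\<^bsub>dan_alg d P\<^esub> dan_y2 d P
      = dan_class d P (var_X ^ d * var_Y2)"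
    using hom by (simp add: dan_x_def dan_y2_def flip: pow)
  then show ?thesis by (simp add: dan_class_eq_iff)
qed

end

theory Submission
  imports Defs "HOL-Computational_Algebra.Formal_Laurent_Series"
    "HOL-Computational_Algebra.Polynomial_FPS"
begin

text \<open>
  Every locally nilpotent derivation \<open>\<delta>\<close> of \<open>B\<close> kills \<open>x\<close>. Granting this, \<open>\<alpha>\<^sup>-\<^sup>1 \<delta> \<alpha>\<close> is also
  locally nilpotent, so \<open>\<Delta> = \<delta> \<alpha> - \<alpha> \<delta>\<close> kills \<open>x\<close>; it satisfies a Leibniz rule twisted by \<open>\<alpha>\<close>,
  and applying it to \<open>x\<^sup>d y\<^sub>2 = P(x, y\<^sub>1)\<close> gives \<open>\<alpha>(x)\<^sup>d \<Delta>(y\<^sub>2) = \<alpha>(P'(x, y\<^sub>1)) \<Delta>(y\<^sub>1)\<close>. As \<open>B\<close> is a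
  domain, \<open>\<Delta>(y\<^sub>1)\<close> and \<open>\<Delta>(y\<^sub>2)\<close> vanish together, and then \<open>\<Delta> = 0\<close>.

  To see that \<open>\<delta>(x) = 0\<close>, embed \<open>B\<close> into \<open>k((x))[y]\<close> by \<open>y\<^sub>1 \<mapsto> y\<close>, \<open>y\<^sub>2 \<mapsto> x\<^sup>-\<^sup>d P(x, y)\<close>, where
  \<open>\<delta> = u \<partial>\<^sub>x + v \<partial>\<^sub>y\<close>. Attach to an element the exponent \<open>(i, n)\<close> of its leading term, first by
  degree in \<open>y\<close> and then by lowest order in \<open>x\<close>. For suitable \<open>(p, q)\<close> and scalars \<open>(a, b) \<noteq> (0, 0)\<close>,
  \<open>\<delta>\<close> moves the exponent by \<open>(p, q)\<close> and multiplies the leading coefficient by \<open>i a + n b\<close>. Nilpotency on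
  \<open>x\<close>, \<open>y\<^sub>1\<close>, \<open>y\<^sub>2\<close> forces \<open>a, b\<close> to be proportional to natural numbers \<open>N, M\<close> with \<open>p N + q M = -1\<close> and
  \<open>r M \<ge> d N\<close>, while exponents of elements of \<open>B\<close> satisfy \<open>i \<ge> - d \<lfloor>n / r\<rfloor>\<close>. If \<open>u \<noteq> 0\<close> then
  \<open>q \<ge> 0\<close>, and for \<open>d, r \<ge> 2\<close> these conditions are incompatible.
\<close>

section \<open>Leading terms and vector fields over Laurent series\<close>

text \<open>The coefficient \<open>c\<close> may be zero, so that symbols can be added and multiplied freely.\<close>

definition has_symbol :: "'k::field_char_0 fls poly \<Rightarrow> int \<Rightarrow> nat \<Rightarrow> 'k \<Rightarrow> bool" where
  "has_symbol f i n c \<longleftrightarrow> degree f \<le> n \<and>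
     (\<forall>j < i. fls_nth (poly.coeff f n) j = 0) \<and> fls_nth (poly.coeff f n) i = c"

lemma has_symbol_zero [simp]: "has_symbol 0 i n c \<longleftrightarrow> c = 0"
  by (auto simp: has_symbol_def)

lemma has_symbol_add:
  "has_symbol f i n a \<Longrightarrow> has_symbol g i n b \<Longrightarrow> has_symbol (f + g) i n (a + b)"
  by (auto simp: has_symbol_def degree_add_le)

text \<open>If one of the degree bounds is strict, both sides vanish. This is what lets symbols
  multiply even when a coefficient is zero.\<close>

lemma coeff_mult_degree_le:
  fixes f g :: "'a::comm_semiring_0 poly"
  assumes "degree f \<le> n" "degree g \<le> m"
  shows "poly.coeff (f * g) (n + m) = poly.coeff f n * poly.coeff g m"
proof (cases "degree f = n \<and> degree g = m")
  case True
  then show ?thesis using coeff_mult_degree_sum[of f g] by simp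
next
  case False
  then have "degree f + degree g < n + m" using assms by auto
  then have "poly.coeff (f * g) (n + m) = 0"
    using degree_mult_le[of f g] by (intro coeff_eq_0) linarith
  moreover have "poly.coeff f n = 0 \<or> poly.coeff g m = 0"
    using False assms by (auto intro: coeff_eq_0 simp: le_less)
  ultimately show ?thesis by auto
qed

lemma fls_times_nth_order:
  fixes f g :: "'a::field fls"
  assumes "\<forall>k < i. fls_nth f k = 0" "\<forall>k < j. fls_nth g k = 0"
  shows "\<forall>k < i + j. fls_nth (f * g) k = 0" "fls_nth (f * g) (i + j) = fls_nth f i * fls_nth g j"
proof -
  show "\<forall>k < i + j. fls_nth (f * g) k = 0"
  proof (cases "f = 0 \<or> g = 0")
    case False
    then have "i \<le> fls_subdegree f" "j \<le> fls_subdegree g"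
      using assms by (auto intro: fls_subdegree_geI)
    then show ?thesis by (auto intro: fls_times_nth_eq0)
  qed auto
  show "fls_nth (f * g) (i + j) = fls_nth f i * fls_nth g j"
  proof (cases "f = 0 \<or> g = 0")
    case False
    then have le: "i \<le> fls_subdegree f" "j \<le> fls_subdegree g"
      using assms by (auto intro: fls_subdegree_geI)
    show ?thesis
    proof (cases "i = fls_subdegree f \<and> j = fls_subdegree g")
      case False
      then have "i + j < fls_subdegree f + fls_subdegree g"
        and "i < fls_subdegree f \<or> j < fls_subdegree g" using le by auto
      then show ?thesis by (auto simp: fls_times_nth_eq0)
    qed auto
  qed auto
qed

lemma has_symbol_mult:
  assumes "has_symbol f i n a" "has_symbol g j m b"
  shows "has_symbol (f * g) (i + j) (n + m) (a * b)"
proof -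
  note order = fls_times_nth_order[of i "poly.coeff f n" j "poly.coeff g m"]
  show ?thesis
    using assms degree_mult_le[of f g] order(1) order(2)
    unfolding has_symbol_def by (simp add: coeff_mult_degree_le)
qed

text \<open>A nonzero coefficient makes the bounds on degree and order sharp, so the symbol is the
  true leading term.\<close>

lemma has_symbol_unique_nonzero: "has_symbol f i n c \<Longrightarrow> c \<noteq> 0 \<Longrightarrow>
    f \<noteq> 0 \<and> degree f = n \<and> fls_subdegree (lead_coeff f) = i"
  unfolding has_symbol_def
  by (metis coeff_0 fls_subdegree_eqI le_antisym le_degree zero_fls.rep_eq)

section \<open>Derivatives in x and y and their effect on symbols\<close>

definition laurent_dx :: "'k::field_char_0 fls poly \<Rightarrow> 'k fls poly" where
  "laurent_dx = map_poly fls_deriv"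

lemma coeff_laurent_dx [simp]: "poly.coeff (laurent_dx f) n = fls_deriv (poly.coeff f n)"
  by (simp add: laurent_dx_def coeff_map_poly)

lemma laurent_dx_add: "laurent_dx (f + g) = laurent_dx f + laurent_dx g"
  by (simp add: poly_eq_iff)

lemma laurent_dx_mult: "laurent_dx (f * g) = laurent_dx f * g + f * laurent_dx g"
proof -
  have "fls_deriv (sum h A) = sum (\<lambda>i. fls_deriv (h i)) A" for h :: "nat \<Rightarrow> 'a fls" and A
    by (induction A rule: infinite_finite_induct) auto
  then show ?thesis
    by (simp add: poly_eq_iff coeff_mult fls_deriv_mult sum.distrib add.commute)
qed

lemma has_symbol_laurent_dx:
  assumes "has_symbol f i n c"
  shows "has_symbol (laurent_dx f) (i - 1) n (of_int i * c)"
proof -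
  have "degree (laurent_dx f) \<le> degree f"
    unfolding laurent_dx_def by (rule map_poly_degree_leq)
  then show ?thesis using assms by (auto simp: has_symbol_def)
qed

text \<open>The index \<open>Suc q\<close> for \<open>v\<close> makes up for the degree lost by
  \<open>pderiv\<close> without truncated subtraction. For \<open>n = 0\<close> the derivative and
  the factor \<open>of_nat n\<close> both vanish.\<close>

lemma has_symbol_mult_pderiv:
  assumes "has_symbol f i n c" "has_symbol v p (Suc q) b"
  shows "has_symbol (v * pderiv f) (i + p) (n + q) (of_nat n * b * c)"
proof (cases n)
  case 0
  then have "pderiv f = 0" using assms by (simp add: has_symbol_def pderiv_eq_0_iff)
  then show ?thesis using 0 by simp
next
  case (Suc m)
  have "has_symbol (pderiv f) i m (of_nat n * c)"
    using assms Suc degree_pderiv[of f]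
    by (auto simp: has_symbol_def coeff_pderiv simp del: of_nat_Suc)
  then show ?thesis using has_symbol_mult[OF assms(2)] Suc by (fastforce simp: algebra_simps)
qed

definition vector_field :: "'k::field_char_0 fls poly \<Rightarrow> 'k fls poly \<Rightarrow> 'k fls poly \<Rightarrow> 'k fls poly" where
  "vector_field u v f = u * laurent_dx f + v * pderiv f"

text \<open>With \<open>u\<close> at (p + 1, q) and \<open>v\<close> at (p, q + 1), both summands
  land on the same exponent; differentiation in x contributes the factor i, in y the factor
  n.\<close>

lemma has_symbol_vector_field:
  assumes "has_symbol u (p + 1) q a" "has_symbol v p (Suc q) b" "has_symbol f i n c"
  shows "has_symbol (vector_field u v f) (i + p) (n + q) ((of_int i * a + of_nat n * b) * c)"
proof -
  have "has_symbol (u * laurent_dx f) (i + p) (n + q) (a * (of_int i * c))"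
    using has_symbol_mult[OF assms(1) has_symbol_laurent_dx[OF assms(3)]]
    by (simp add: algebra_simps)
  from has_symbol_add[OF this has_symbol_mult_pderiv[OF assms(3,2)]]
  show ?thesis by (simp add: vector_field_def algebra_simps)
qed

lemma has_symbol_iterate:
  assumes "has_symbol u (p + 1) q a" "has_symbol v p (Suc q) b" "has_symbol f i n c" "c \<noteq> 0"
    and "\<forall>k < N. of_int (i + int k * p) * a + of_nat (n + k * q) * b \<noteq> 0"
  shows "\<exists>e. e \<noteq> 0 \<and> has_symbol ((vector_field u v ^^ N) f) (i + int N * p) (n + N * q) e"
  using assms(5)
proof (induction N)
  case 0
  then show ?case using assms by auto
next
  case (Suc N)
  then obtain e where e: "e \<noteq> 0"
    "has_symbol ((vector_field u v ^^ N) f) (i + int N * p) (n + N * q) e" by auto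
  have "has_symbol ((vector_field u v ^^ Suc N) f) (i + int (Suc N) * p) (n + Suc N * q)
      ((of_int (i + int N * p) * a + of_nat (n + N * q) * b) * e)"
    using has_symbol_vector_field[OF assms(1,2) e(2)] by (simp add: algebra_simps)
  moreover have "of_int (i + int N * p) * a + of_nat (n + N * q) * b \<noteq> 0"
    using Suc.prems by blast
  ultimately show ?case using e(1) by (meson mult_eq_0_iff)
qed

text \<open>If no factor ever vanished, the leading coefficient would survive every iteration,
  against nilpotency.\<close>

lemma nilpotent_symbol:
  assumes "has_symbol u (p + 1) q a" "has_symbol v p (Suc q) b" "has_symbol f i n c" "c \<noteq> 0"
    and "(vector_field u v ^^ N) f = 0"
  shows "\<exists>k. of_int (i + int k * p) * a + of_nat (n + k * q) * b = 0"
  using has_symbol_iterate[OF assms(1-4), of N] assms(5) by (metis has_symbol_zero)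

lemma exists_common_symbol:
  fixes u v :: "'k::field_char_0 fls poly"
  assumes "u \<noteq> 0"
  obtains p q a b where "has_symbol u (p + 1) q a" "has_symbol v p (Suc q) b" "a \<noteq> 0 \<or> b \<noteq> 0"
proof -
  \<comment> \<open>For constant \<open>v\<close> the subtraction truncates to 0, and
    \<open>degree v \<le> Suc q\<close> still holds.\<close>
  define q where "q = max (degree u) (degree v - 1)"
  define U V where "U = poly.coeff u q" and "V = poly.coeff v (Suc q)"
  have deg: "degree u \<le> q" "degree v \<le> Suc q" by (auto simp: q_def)
  have "U \<noteq> 0 \<or> V \<noteq> 0"
  proof (cases "q = degree u")
    case True
    then show ?thesis using assms by (simp add: U_def)
  next
    case False
    then have "Suc q = degree v" by (auto simp: q_def max_def split: if_splits)
    then show ?thesis by (metis V_def degree_0 leading_coeff_0_iff nat.simps(3))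
  qed
  \<comment> \<open>\<open>fls_subdegree 0\<close> is 0 by convention, so a vanishing coefficient
    must be kept out of the minimum.\<close>
  define p where "p = (if U = 0 then fls_subdegree V else if V = 0 then fls_subdegree U - 1
     else min (fls_subdegree U - 1) (fls_subdegree V))"
  have "\<forall>j < p + 1. fls_nth U j = 0" "\<forall>j < p. fls_nth V j = 0"
    by (auto simp: p_def split: if_splits)
  moreover have "fls_nth U (p + 1) \<noteq> 0 \<or> fls_nth V p \<noteq> 0"
    using \<open>U \<noteq> 0 \<or> V \<noteq> 0\<close> by (auto simp: p_def min_def)
  ultimately show thesis
    using that[of p q "fls_nth U (p + 1)" "fls_nth V p"] deg
    by (auto simp: has_symbol_def U_def V_def)
qed

text \<open>The bounds on \<open>p\<close> say that \<open>\<delta>(x)\<close> and \<open>\<delta>(y\<^sub>1)\<close> have exponents that occur in \<open>B\<close>.\<close>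

lemma weight_arith:
  fixes p :: int and q d r M N :: nat
  assumes "d \<ge> 2" "r \<ge> 2" and dual: "p * int N + int q * int M = - 1"
    and rM: "int r * int M \<ge> int d * int N"
    and u: "1 + p \<ge> - int d * int (q div r)"
    and v: "p \<ge> - int d * int (Suc q div r)"
  shows False
proof -
  have "N \<noteq> 0"
  proof
    assume "N = 0"
    then have "int (q * M) = - 1" using dual by simp
    then show False by linarith
  qed
  show False
  proof (cases "Suc q mod r = 0")
    \<comment> \<open>Here q and q + 1 have the same quotient t, and p N + q M \<ge> t (r M - d N)
      \<ge> 0 contradicts \<open>dual\<close>.\<close>
    case False
    define t where "t = int (q div r)"
    have t: "int (Suc q div r) = t" using False by (simp add: t_def div_Suc)
    have q: "int q \<ge> int r * t" by (simp add: t_def flip: of_nat_mult)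
    have "t \<ge> 0" by (simp add: t_def)
    have "p * int N \<ge> - int d * t * int N" using v t by (intro mult_right_mono) auto
    moreover have "int q * int M \<ge> int r * t * int M" using q by (intro mult_right_mono) auto
    moreover have "t * (int r * int M) \<ge> t * (int d * int N)"
      using rM \<open>t \<ge> 0\<close> by (intro mult_left_mono)
    ultimately show False using dual by (simp add: algebra_simps)
  next
    \<comment> \<open>Here q = r (t + 1) - 1, and \<open>v\<close> gives only p \<ge> - d (t + 1).
      The bound \<open>u\<close>, that is p \<ge> - d t - 1, is the sharper one.\<close>
    case True
    define t where "t = int (q div r)"
    have "Suc q = r * Suc (q div r)"
      using True by (metis div_Suc mult_div_mod_eq add.right_neutral)
    then have q: "int q = int r * (t + 1) - 1"
      unfolding t_def
      by (metis Suc_eq_plus1 add_diff_cancel_right' of_nat_Suc of_nat_mult add.commute)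
    have "t \<ge> 0" by (simp add: t_def)
    have "p * int N \<ge> (- 1 - int d * t) * int N" using u by (intro mult_right_mono) (auto simp: t_def)
    then have 1: "- 1 \<ge> (- 1 - int d * t) * int N + (int r * (t + 1) - 1) * int M"
      using dual q by simp
    \<comment> \<open>Multiplying by r turns M into r M, which \<open>rM\<close> bounds below by d
      N; the terms in t then cancel.\<close>
    have "(int r * (t + 1) - 1) * (int r * int M) \<ge> (int r * (t + 1) - 1) * (int d * int N)"
      using rM q by (intro mult_left_mono) auto
    moreover have "int r * (- 1) \<ge> int r * ((- 1 - int d * t) * int N + (int r * (t + 1) - 1) * int M)"
      using 1 by (intro mult_left_mono) auto
    ultimately have 2: "- int r \<ge> (int r * int d - int d - int r) * int N"
      by (simp add: algebra_simps)
    \<comment> \<open>This is where d, r \<ge> 2 enter: r d - d - r = (r - 1)(d - 1) - 1 is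
      nonnegative.\<close>
    have "(int r - 1) * (int d - 1) \<ge> 1 * 1" using assms by (intro mult_mono) auto
    then have "int r * int d - int d - int r \<ge> 0" by (simp add: algebra_simps)
    then have "(int r * int d - int d - int r) * int N \<ge> 0" by simp
    then show False using 2 \<open>r \<ge> 2\<close> by linarith
  qed
qed

section \<open>The embedding of the coordinate ring\<close>

lemma map_poly_hom_add:
  fixes h :: "'a::comm_semiring_0 \<Rightarrow> 'b::comm_semiring_0"
  assumes "h 0 = 0" "\<And>a b. h (a + b) = h a + h b"
  shows "map_poly h (p + q) = map_poly h p + map_poly h q"
  using assms by (simp add: poly_eq_iff coeff_map_poly)

lemma map_poly_hom_mult:
  fixes h :: "'a::comm_semiring_0 \<Rightarrow> 'b::comm_semiring_0"
  assumes "h 0 = 0" "\<And>a b. h (a + b) = h a + h b" "\<And>a b. h (a * b) = h a * h b"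
  shows "map_poly h (p * q) = map_poly h p * map_poly h q"
  by (induction p)
    (simp_all add: map_poly_pCons[of h, OF assms(1)] map_poly_hom_add[of h, OF assms(1,2)]
      map_poly_smult[of h, OF assms(1,3)] assms(1))

definition laurent_of_poly :: "'k::field_char_0 poly \<Rightarrow> 'k fls" where
  "laurent_of_poly p = fps_to_fls (fps_of_poly p)"

lemma laurent_of_poly_simps [simp]:
  "laurent_of_poly 0 = 0" "laurent_of_poly 1 = 1"
  "laurent_of_poly (p + q) = laurent_of_poly p + laurent_of_poly q"
  "laurent_of_poly (p * q) = laurent_of_poly p * laurent_of_poly q"
  "laurent_of_poly p = 0 \<longleftrightarrow> p = 0"
  by (simp_all add: laurent_of_poly_def fps_of_poly_add fps_of_poly_mult fls_times_fps_to_fls)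

lemma laurent_of_poly_pCons:
  "laurent_of_poly (pCons c p) = fls_const c + fls_X * laurent_of_poly p"
  by (simp add: laurent_of_poly_def fps_of_poly_pCons fls_times_fps_to_fls fls_X_times_comm)

definition laurent_emb :: "'k::field_char_0 poly poly \<Rightarrow> 'k fls poly" where
  "laurent_emb = map_poly laurent_of_poly"

lemma laurent_emb_simps [simp]:
  "laurent_emb 0 = 0" "laurent_emb 1 = 1"
  "laurent_emb (p + q) = laurent_emb p + laurent_emb q"
  "laurent_emb (p * q) = laurent_emb p * laurent_emb q"
  "laurent_emb (pCons a p) = pCons (laurent_of_poly a) (laurent_emb p)"
  "poly.coeff (laurent_emb p) n = laurent_of_poly (poly.coeff p n)"
  by (simp_all add: laurent_emb_def map_poly_hom_add map_poly_hom_mult map_poly_pCons coeff_map_poly)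

lemma laurent_emb_eq_0_iff [simp]: "laurent_emb p = 0 \<longleftrightarrow> p = 0"
  by (simp add: poly_eq_iff)

lemma degree_laurent_emb [simp]: "degree (laurent_emb p) = degree p"
  by (cases "p = 0") (simp_all add: laurent_emb_def map_poly_degree_eq)

text \<open>The value that x^d y_2 = P forces on y_2 once x is invertible.\<close>

definition y2_image :: "nat \<Rightarrow> 'k::field_char_0 poly poly \<Rightarrow> 'k fls poly" where
  "y2_image d P = smult (fls_X_inv ^ d) (laurent_emb P)"

text \<open>For monic P of positive degree the kernel is the ideal of the defining relation, so the
  range of this map is a copy of B inside k((x))[y].\<close>

definition dan_emb :: "nat \<Rightarrow> 'k::field_char_0 poly poly \<Rightarrow> 'k poly poly poly \<Rightarrow> 'k fls poly" where
  "dan_emb d P F = poly (map_poly laurent_emb F) (y2_image d P)"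

lemma dan_emb_simps [simp]:
  "dan_emb d P 0 = 0" "dan_emb d P 1 = 1"
  "dan_emb d P (F + G) = dan_emb d P F + dan_emb d P G"
  "dan_emb d P (F * G) = dan_emb d P F * dan_emb d P G"
  "dan_emb d P (pCons g F) = laurent_emb g + y2_image d P * dan_emb d P F"
  by (simp_all add: dan_emb_def map_poly_hom_add map_poly_hom_mult map_poly_pCons)

lemma dan_emb_diff [simp]: "dan_emb d P (F - G) = dan_emb d P F - dan_emb d P G"
  by (metis add_diff_cancel_right' diff_add_cancel dan_emb_simps(3))

lemma dan_emb_power [simp]: "dan_emb d P (F ^ n) = dan_emb d P F ^ n"
  by (induction n) simp_all

lemma dan_emb_vars:
  "dan_emb d P var_X = [:fls_X:]" "dan_emb d P var_Y1 = [:0, 1:]"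
  "dan_emb d P var_Y2 = y2_image d P" "dan_emb d P [:[:[:c:]:]:] = [:fls_const c:]"
  by (simp_all add: var_X_def var_Y1_def var_Y2_def laurent_of_poly_pCons flip: one_pCons)

lemma y2_image_relation: "[:fls_X:] ^ d * y2_image d P = laurent_emb P"
proof -
  have "fls_X ^ d * fls_X_inv ^ d = (1 :: 'a fls)"
    by (metis power_mult_distrib fls_inverse_X fls_X_nonzero right_inverse power_one)
  then show ?thesis by (simp add: y2_image_def poly_const_pow mult.commute)
qed

lemma range_dan_emb [simp]:
  "laurent_emb G \<in> range (dan_emb d P)" "[:fls_const c:] \<in> range (dan_emb d P)"
  "[:fls_X:] \<in> range (dan_emb d P)" "[:0, 1:] \<in> range (dan_emb d P)"
  "y2_image d P \<in> range (dan_emb d P)" "[:laurent_of_poly p:] \<in> range (dan_emb d P)"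
  "0 \<in> range (dan_emb d P)"
proof -
  show emb: "laurent_emb G \<in> range (dan_emb d P)" for G
    using rangeI[of "dan_emb d P" "[:G:]"] by simp
  from emb[of "[:p:]"] show "[:laurent_of_poly p:] \<in> range (dan_emb d P)" by simp
  from emb[of 0] show "0 \<in> range (dan_emb d P)" by simp
  show "[:fls_const c:] \<in> range (dan_emb d P)"
    using rangeI[of "dan_emb d P" "[:[:[:c:]:]:]"] by (simp only: dan_emb_vars)
  show "[:fls_X:] \<in> range (dan_emb d P)"
    using rangeI[of "dan_emb d P" var_X] by (simp only: dan_emb_vars)
  show "[:0, 1:] \<in> range (dan_emb d P)"
    using rangeI[of "dan_emb d P" var_Y1] by (simp only: dan_emb_vars)
  show "y2_image d P \<in> range (dan_emb d P)"
    using rangeI[of "dan_emb d P" var_Y2] by (simp only: dan_emb_vars)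
qed

lemma range_dan_emb_ops [simp]:
  "\<lbrakk>f \<in> range (dan_emb d P); g \<in> range (dan_emb d P)\<rbrakk> \<Longrightarrow> f + g \<in> range (dan_emb d P)"
  "\<lbrakk>f \<in> range (dan_emb d P); g \<in> range (dan_emb d P)\<rbrakk> \<Longrightarrow> f * g \<in> range (dan_emb d P)"
  "f \<in> range (dan_emb d P) \<Longrightarrow> f ^ n \<in> range (dan_emb d P)"
  by (auto simp flip: dan_emb_simps(3,4) dan_emb_power)

section \<open>Normal forms modulo the defining relation\<close>

definition dan_gen :: "nat \<Rightarrow> 'k::field_char_0 poly poly \<Rightarrow> 'k poly poly poly" where
  "dan_gen d P = var_X ^ d * var_Y2 - [:P:]"

lemma dan_gen_eq: "dan_gen d P = [:- P, [:[:0, 1:] ^ d:]:]"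
  by (simp add: dan_gen_def var_X_def var_Y2_def poly_const_pow)

lemma dan_emb_gen: "dan_emb d P (dan_gen d P) = 0"
  by (simp add: dan_gen_def dan_emb_vars y2_image_relation)

text \<open>Divide g by P in Y_1: g = P q + h. Modulo the generator P q becomes X^d q Y_2, and X^d q
  has smaller Y_1-degree than g, so induction applies to it.\<close>

lemma reduce_const:
  fixes P :: "'k::field_char_0 poly poly"
  assumes "lead_coeff P = 1" "degree P > 0"
  shows "\<exists>F. (\<forall>l. degree (poly.coeff F l) < degree P) \<and> dan_gen d P dvd [:g:] - F"
proof (induction "degree g" arbitrary: g rule: less_induct)
  case less
  show ?case
  proof (cases "degree g < degree P")
    case True
    then have "\<forall>l. degree (poly.coeff [:g:] l) < degree P"
      using assms by (auto simp: coeff_pCons split: nat.split)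
    then show ?thesis by (intro exI[of _ "[:g:]"]) simp
  next
    case False
    \<comment> \<open>As P is monic, pseudo-division is division with remainder.\<close>
    obtain q h where qh: "pseudo_divmod g P = (q, h)" by force
    have "P \<noteq> 0" using assms by auto
    from pseudo_divmod[OF this qh] assms have g: "g = P * q + h" and "h = 0 \<or> degree h < degree P"
      by simp_all
    then have h: "degree h < degree P" using assms by auto
    have "q \<noteq> 0" using False g h by auto
    define q' where "q' = [:[:0, 1:] ^ d:] * q"
    have "degree q' = degree q" by (simp add: q'_def)
    moreover have "degree g = degree P + degree q"
      using h \<open>q \<noteq> 0\<close> \<open>P \<noteq> 0\<close> unfolding g
      by (subst degree_add_eq_left) (simp_all add: degree_mult_eq)
    ultimately have "degree q' < degree g" using assms by simp
    from less(1)[OF this] obtain F where F: "\<forall>l. degree (poly.coeff F l) < degree P"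
      "dan_gen d P dvd [:q':] - F" by blast
    have "[:g:] - pCons h F = [:0, 1:] * ([:q':] - F) - [:q:] * dan_gen d P"
      by (simp add: dan_gen_eq g q'_def mult.commute)
    then have "dan_gen d P dvd [:g:] - pCons h F"
      using F(2) by (metis dvd_diff dvd_mult dvd_triv_right)
    moreover have "degree (poly.coeff (pCons h F) l) < degree P" for l
      using F(1) h by (simp add: coeff_pCons split: nat.split)
    ultimately show ?thesis by blast
  qed
qed

text \<open>Horner induction in Y_2, with the constant coefficient handled by
  \<open>reduce_const\<close>. Leading terms of the image can be read off from such
  representatives.\<close>

lemma reduce:
  fixes P :: "'k::field_char_0 poly poly"
  assumes "lead_coeff P = 1" "degree P > 0"
  shows "\<exists>F'. (\<forall>l. degree (poly.coeff F' l) < degree P) \<and> dan_gen d P dvd F - F'"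
proof (induction F)
  case 0
  show ?case using assms by (intro exI[of _ 0]) simp
next
  case (pCons g F)
  then obtain F' where F': "\<forall>l. degree (poly.coeff F' l) < degree P" "dan_gen d P dvd F - F'"
    by blast
  obtain G where G: "\<forall>l. degree (poly.coeff G l) < degree P" "dan_gen d P dvd [:g:] - G"
    using reduce_const[OF assms] by blast
  have "pCons g F - (G + pCons 0 F') = ([:g:] - G) + [:0, 1:] * (F - F')" by simp
  then have "dan_gen d P dvd pCons g F - (G + pCons 0 F')"
    using F'(2) G(2) by (metis dvd_add dvd_mult)
  moreover have "degree (poly.coeff (G + pCons 0 F') l) < degree P" for l
    using F'(1) G(1) assms by (auto simp: coeff_pCons intro!: degree_add_less split: nat.split)
  ultimately show ?case by blast
qed

section \<open>Leading exponents of elements of the range\<close>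

lemma y2_image_lead:
  assumes "lead_coeff P = 1"
  shows "degree (y2_image d P) = degree P" "lead_coeff (y2_image d P) = fls_X_inv ^ d"
  using assms by (simp_all add: y2_image_def)

text \<open>Horner induction: y_2 has y-degree \<open>degree P\<close>, which exceeds the degree of
  g, so adding g cannot disturb the leading term. Each factor y_2 raises the degree by
  \<open>degree P\<close> and lowers the order by d; the start is a polynomial in x, of order at
  least 0.\<close>

lemma dan_emb_order_reduced:
  fixes P :: "'k::field_char_0 poly poly"
  assumes "lead_coeff P = 1" "\<forall>l. degree (poly.coeff F l) < degree P" "F \<noteq> 0"
  shows "dan_emb d P F \<noteq> 0 \<and> fls_subdegree (lead_coeff (dan_emb d P F))
     \<ge> - int d * int (degree (dan_emb d P F) div degree P)"
  using assms(2,3)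
proof (induction F)
  case (pCons g F)
  have g: "degree g < degree P" using pCons.prems(1)[rule_format, of 0] by simp
  show ?case
  proof (cases "F = 0")
    case True
    then have "g \<noteq> 0" using pCons by simp
    then show ?thesis using True g by (simp add: laurent_of_poly_def fls_subdegree_fls_to_fps)
  next
    case False
    define h where "h = dan_emb d P F"
    have "\<forall>l. degree (poly.coeff F l) < degree P"
      using pCons.prems(1) by (metis coeff_pCons_Suc)
    then have h: "h \<noteq> 0" "fls_subdegree (lead_coeff h) \<ge> - int d * int (degree h div degree P)"
      using pCons.IH False by (simp_all add: h_def)
    have y2: "y2_image d P \<noteq> 0" using g y2_image_lead[OF assms(1), of d] by auto
    have deg: "degree (y2_image d P * h) = degree P + degree h"
      using h y2 by (simp add: degree_mult_eq y2_image_lead[OF assms(1)])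
    then have less: "degree (laurent_emb g) < degree (y2_image d P * h)" using g by simp
    have D: "degree (dan_emb d P (pCons g F)) = degree P + degree h"
      using degree_add_eq_right[OF less] deg by (simp add: h_def)
    have L: "lead_coeff (dan_emb d P (pCons g F)) = fls_X_inv ^ d * lead_coeff h"
      using lead_coeff_add_le[OF less] y2_image_lead[OF assms(1)]
      by (simp add: h_def lead_coeff_mult)
    have "fls_subdegree (fls_X_inv ^ d * lead_coeff h) = fls_subdegree (lead_coeff h) - int d"
      using h by (simp add: fls_subdegree_mult_fls_X_inv_power)
    moreover have "(degree P + degree h) div degree P = Suc (degree h div degree P)"
      using g by simp
    ultimately have "fls_subdegree (fls_X_inv ^ d * lead_coeff h)
     \<ge> - int d * int ((degree P + degree h) div degree P)"
      using h(2) by (simp add: algebra_simps)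
    then have "fls_subdegree (lead_coeff (dan_emb d P (pCons g F)))
     \<ge> - int d * int (degree (dan_emb d P (pCons g F)) div degree P)"
      by (simp only: L, simp only: D)
    moreover have "dan_emb d P (pCons g F) \<noteq> 0" using D g by auto
    ultimately show ?thesis by blast
  qed
qed simp

lemma dan_emb_order:
  fixes P :: "'k::field_char_0 poly poly"
  assumes "lead_coeff P = 1" "degree P > 0" "f \<in> range (dan_emb d P)" "f \<noteq> 0"
  shows "fls_subdegree (lead_coeff f) \<ge> - int d * int (degree f div degree P)"
proof -
  obtain F where F: "f = dan_emb d P F" using assms by auto
  obtain F' where F': "\<forall>l. degree (poly.coeff F' l) < degree P" "dan_gen d P dvd F - F'"
    using reduce[OF assms(1,2)] by blast
  from F'(2) have "dan_emb d P (F - F') = 0" by (metis dan_emb_gen dan_emb_simps(4) dvdE mult_zero_left)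
  then have "f = dan_emb d P F'" using F by simp
  moreover from this have "F' \<noteq> 0" using assms(4) by auto
  ultimately show ?thesis using dan_emb_order_reduced[OF assms(1) F'(1), of d] by simp
qed

text \<open>A nonzero normal form has nonzero image, so an element of the kernel reduces to
  0.\<close>

lemma dan_emb_eq_0_iff:
  fixes P :: "'k::field_char_0 poly poly"
  assumes "lead_coeff P = 1" "degree P > 0"
  shows "dan_emb d P F = 0 \<longleftrightarrow> dan_gen d P dvd F"
proof
  assume 0: "dan_emb d P F = 0"
  obtain F' where F': "\<forall>l. degree (poly.coeff F' l) < degree P" "dan_gen d P dvd F - F'"
    using reduce[OF assms(1,2)] by blast
  from F'(2) have "dan_emb d P (F - F') = 0" by (metis dan_emb_gen dan_emb_simps(4) dvdE mult_zero_left)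
  then have "F' = 0" using dan_emb_order_reduced[OF assms(1) F'(1)] 0 by auto
  then show "dan_gen d P dvd F" using F' by simp
qed (metis dan_emb_gen dan_emb_simps(4) dvdE mult_zero_left)

section \<open>Locally nilpotent derivations kill \<open>x\<close>\<close>

text \<open>Used twice: with \<open>a = id\<close> to compare a derivation with a vector field, and
  with an automorphism \<open>a\<close> for its commutator with a derivation. All laws are confined
  to the copy of B.\<close>

locale twisted_derivation =
  fixes d :: nat and P :: "'k::field_char_0 poly poly"
    and a D :: "'k fls poly \<Rightarrow> 'k fls poly"
  assumes a_add: "\<lbrakk>f \<in> range (dan_emb d P); g \<in> range (dan_emb d P)\<rbrakk> \<Longrightarrow> a (f + g) = a f + a g"
    and a_mult: "\<lbrakk>f \<in> range (dan_emb d P); g \<in> range (dan_emb d P)\<rbrakk> \<Longrightarrow> a (f * g) = a f * a g"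
    and D_add: "\<lbrakk>f \<in> range (dan_emb d P); g \<in> range (dan_emb d P)\<rbrakk> \<Longrightarrow> D (f + g) = D f + D g"
    and D_mult: "\<lbrakk>f \<in> range (dan_emb d P); g \<in> range (dan_emb d P)\<rbrakk> \<Longrightarrow> D (f * g) = D f * a g + a f * D g"
    and D_const: "D [:fls_const c:] = 0"
    and D_x: "D [:fls_X:] = 0"
    and a_x: "a [:fls_X:] \<noteq> 0"
begin

lemma D_zero: "D 0 = 0"
  using D_const[of 0] by simp

lemma a_zero: "a 0 = 0"
  using a_add[of 0 0] rangeI[of "dan_emb d P" 0] by simp

lemma D_poly_x: "D [:laurent_of_poly p:] = 0"
proof (induction p)
  case (pCons c p)
  have "[:laurent_of_poly (pCons c p):] = [:fls_const c:] + [:fls_X:] * [:laurent_of_poly p:]"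
    by (simp add: laurent_of_poly_pCons)
  then show ?case
    by (simp only:) (simp add: D_add D_mult D_const D_x pCons del: mult_pCons_left mult_pCons_right)
qed (simp add: D_zero)

text \<open>The chain rule; the x-part is absent because \<open>D\<close> kills polynomials in
  x.\<close>

lemma D_laurent_emb: "D (laurent_emb G) = a (laurent_emb (pderiv G)) * D [:0, 1:]"
proof (induction G)
  case (pCons p G)
  have "laurent_emb (pCons p G) = [:laurent_of_poly p:] + [:0, 1:] * laurent_emb G" by simp
  then have "D (laurent_emb (pCons p G)) = D [:0, 1:] * a (laurent_emb G) + a [:0, 1:] * D (laurent_emb G)"
    by (simp only:) (simp add: D_add D_mult D_poly_x del: mult_pCons_left mult_pCons_right)
  moreover have "laurent_emb (pderiv (pCons p G)) = laurent_emb G + [:0, 1:] * laurent_emb (pderiv G)"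
    by (simp add: pderiv_pCons)
  then have "a (laurent_emb (pderiv (pCons p G))) = a (laurent_emb G) + a [:0, 1:] * a (laurent_emb (pderiv G))"
    by (simp only:) (simp add: a_add a_mult del: mult_pCons_left mult_pCons_right)
  ultimately show ?case using pCons.IH by (simp add: algebra_simps)
qed (simp add: D_zero a_zero)

text \<open>Only positive powers, since the locale does not assume that \<open>a\<close> preserves
  1.\<close>

lemma a_power:
  assumes "f \<in> range (dan_emb d P)"
  shows "a (f ^ Suc n) = a f ^ Suc n"
  using assms by (induction n) (simp_all add: a_mult)

lemma D_x_power: "D ([:fls_X:] ^ n) = 0"
proof (induction n)
  case 0
  show ?case using D_const[of 1] by (simp flip: one_pCons)
next
  case (Suc n)
  have "D ([:fls_X:] * [:fls_X:] ^ n) = 0"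
    using Suc D_x by (subst D_mult) simp_all
  then show ?case by simp
qed

text \<open>Apply \<open>D\<close> to x^d y_2 = P(x, y_1), with the chain rule on the right.\<close>

lemma D_y2:
  assumes "d > 0"
  shows "a [:fls_X:] ^ d * D (y2_image d P) = a (laurent_emb (pderiv P)) * D [:0, 1:]"
proof -
  obtain n where n: "d = Suc n" using assms by (cases d) auto
  have "D ([:fls_X:] ^ d * y2_image d P) = a ([:fls_X:] ^ d) * D (y2_image d P)"
    using D_x_power[of d] by (subst D_mult) simp_all
  moreover have "a ([:fls_X:] ^ d) = a [:fls_X:] ^ d"
    unfolding n by (rule a_power) simp
  ultimately show ?thesis by (simp add: y2_image_relation D_laurent_emb)
qed

lemma D_y1_eq_0_iff:
  assumes "d > 0" "a (laurent_emb (pderiv P)) \<noteq> 0"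
  shows "D [:0, 1:] = 0 \<longleftrightarrow> D (y2_image d P) = 0"
  using D_y2[OF assms(1)] assms(2) a_x by (metis mult_eq_0_iff power_not_zero mult_zero_right)

text \<open>\<open>D_y2\<close> and \<open>a_x\<close> force \<open>D\<close> to kill y_2 as well,
  and x, y_1, y_2 generate the range over k.\<close>

lemma D_vanishes:
  assumes "d > 0" "D [:0, 1:] = 0" "f \<in> range (dan_emb d P)"
  shows "D f = 0"
proof -
  have y2: "D (y2_image d P) = 0"
    using D_y2[OF assms(1)] assms(2) a_x by simp
  have "D (dan_emb d P F) = 0" for F
    by (induction F) (simp_all add: D_zero D_add D_mult y2 D_laurent_emb assms(2))
  then show ?thesis using assms(3) by blast
qed

end

section \<open>Locally nilpotent derivations on the copy of B\<close>

locale laurent_lnd =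
  fixes d :: nat and P :: "'k::field_char_0 poly poly"
    and E :: "'k fls poly \<Rightarrow> 'k fls poly"
  assumes d: "d \<ge> 2" and P: "lead_coeff P = 1" "degree P \<ge> 2"
    and E_range: "f \<in> range (dan_emb d P) \<Longrightarrow> E f \<in> range (dan_emb d P)"
    and E_add: "\<lbrakk>f \<in> range (dan_emb d P); g \<in> range (dan_emb d P)\<rbrakk> \<Longrightarrow> E (f + g) = E f + E g"
    and E_mult: "\<lbrakk>f \<in> range (dan_emb d P); g \<in> range (dan_emb d P)\<rbrakk> \<Longrightarrow> E (f * g) = E f * g + f * E g"
    and E_const: "E [:fls_const c:] = 0"
    and E_nilpotent: "f \<in> range (dan_emb d P) \<Longrightarrow> \<exists>n. (E ^^ n) f = 0"
begin

abbreviation "u \<equiv> E [:fls_X:]"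
abbreviation "v \<equiv> E [:0, 1:]"

text \<open>The difference of the two sides is a derivation that kills x and y_1, hence vanishes by
  \<open>D_vanishes\<close> with trivial twist.\<close>

lemma E_eq_vector_field:
  assumes "f \<in> range (dan_emb d P)"
  shows "E f = vector_field u v f"
proof -
  have dx: "laurent_dx [:c:] = [:fls_deriv c:]" "laurent_dx (pCons 0 1) = 0" for c :: "'k fls"
    by (simp_all add: laurent_dx_def map_poly_pCons map_poly_1)
  interpret twisted_derivation d P id "\<lambda>f. E f - vector_field u v f"
  proof
    show "E [:fls_X:] - vector_field u v [:fls_X:] = 0"
      by (simp add: vector_field_def dx flip: one_pCons)
    fix f g
    assume fg: "f \<in> range (dan_emb d P)" "g \<in> range (dan_emb d P)"
    show "E (f + g) - vector_field u v (f + g) = E f - vector_field u v f + (E g - vector_field u v g)"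
      unfolding E_add[OF fg] vector_field_def laurent_dx_add pderiv_add by (simp add: algebra_simps)
    show "E (f * g) - vector_field u v (f * g)
        = (E f - vector_field u v f) * id g + id f * (E g - vector_field u v g)"
      unfolding E_mult[OF fg] vector_field_def laurent_dx_mult pderiv_mult
      by (simp add: algebra_simps)
  qed (simp_all add: E_const vector_field_def dx)
  have "v - vector_field u v [:0, 1:] = 0"
    by (simp add: vector_field_def dx pderiv_pCons flip: one_pCons)
  from D_vanishes[OF _ this assms] d show ?thesis by simp
qed

lemma vector_field_nilpotent:
  assumes "f \<in> range (dan_emb d P)"
  shows "\<exists>n. (vector_field u v ^^ n) f = 0"
proof -
  have "(E ^^ n) f \<in> range (dan_emb d P) \<and> (vector_field u v ^^ n) f = (E ^^ n) f" for n
    using assms by (induction n) (auto simp: E_range simp flip: E_eq_vector_field)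
  then show ?thesis using E_nilpotent[OF assms] by metis
qed

lemma E_x: "E [:fls_X:] = 0"
proof (rule ccontr)
  assume "u \<noteq> 0"
  then obtain p q a b where
    sym: "has_symbol u (p + 1) q a" "has_symbol v p (Suc q) b" and ab: "a \<noteq> 0 \<or> b \<noteq> 0"
    using exists_common_symbol by blast
  define r where "r = degree P"
  have zero: "\<exists>k. of_int (i + int k * p) * a + of_nat (n + k * q) * b = 0"
    if "has_symbol f i n 1" "f \<in> range (dan_emb d P)" for f i n
    using nilpotent_symbol[OF sym that(1)] vector_field_nilpotent[OF that(2)] by auto
  \<comment> \<open>The exponents used are (1, 0) for x, (0, 1) for y_1 and, below, (-d, r) for y_2,
    each with coefficient 1.\<close>
  have "has_symbol [:fls_X:] 1 0 (1 :: 'k)" "has_symbol [:0, 1:] 0 1 (1 :: 'k)"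
    by (auto simp: has_symbol_def)
  from this[THEN zero] range_dan_emb obtain N M where
    NM: "of_int (1 + int N * p) * a + of_nat (0 + N * q) * b = 0"
      "of_int (0 + int M * p) * a + of_nat (1 + M * q) * b = 0" by blast
  have "has_symbol (y2_image d P) (- int d) r 1"
    using y2_image_lead[OF P(1), of d] by (simp add: has_symbol_def r_def)
  from zero[OF this] range_dan_emb obtain K where
    "of_int (- int d + int K * p) * a + of_nat (r + K * q) * b = 0" by blast
  note NMK = NM this
  \<comment> \<open>Each application of the vector field lowers the weight i a + n b by
    \<open>c\<close>. Reaching 0 after k steps means that the initial weight is k c, so a = N c, b =
    M c and r b - d a = K c.\<close>
  define c where "c = - (of_int p * a + of_nat q * b)"
  have "a - of_nat N * c = of_int (1 + int N * p) * a + of_nat (0 + N * q) * b"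
    by (simp add: c_def algebra_simps)
  then have a: "a = of_nat N * c" using NMK(1) by simp
  have "b - of_nat M * c = of_int (0 + int M * p) * a + of_nat (1 + M * q) * b"
    by (simp add: c_def algebra_simps)
  then have b: "b = of_nat M * c" using NMK(2) by simp
  have "of_nat r * b - of_nat d * a - of_nat K * c
      = of_int (- int d + int K * p) * a + of_nat (r + K * q) * b"
    by (simp add: c_def algebra_simps)
  then have K: "of_nat r * b - of_nat d * a = of_nat K * c" using NMK(3) by simp
  have "c \<noteq> 0" using a b ab by auto
  \<comment> \<open>Inserting a = N c and b = M c into the definition of \<open>c\<close> and
    cancelling \<open>c\<close> in characteristic zero gives an identity of integers.\<close>
  have "c * of_int (p * int N + int q * int M) = of_int p * (of_nat N * c) + of_nat q * (of_nat M * c)"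
    by (simp add: algebra_simps)
  also have "\<dots> = of_int p * a + of_nat q * b" by (simp only: a[symmetric] b[symmetric])
  also have "\<dots> = c * of_int (- 1)" by (simp add: c_def)
  finally have "c * of_int (p * int N + int q * int M) = c * of_int (- 1)" .
  then have dual: "p * int N + int q * int M = - 1"
    using \<open>c \<noteq> 0\<close> by (simp only: mult_cancel_left of_int_eq_iff) simp
  have "c * of_int (int r * int M - int d * int N) = c * of_int (int K)"
    using K by (simp add: a b algebra_simps)
  then have rM: "int r * int M - int d * int N = int K"
    using \<open>c \<noteq> 0\<close> by (simp only: mult_cancel_left of_int_eq_iff) simp
  \<comment> \<open>Nonzero N and M make \<open>a\<close> and \<open>b\<close> nonzero; only then
    are the symbols of \<open>u\<close> and \<open>v\<close> true leading terms, to which the order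
    bound applies.\<close>
  have "N \<noteq> 0"
  proof
    assume "N = 0"
    then have "int (q * M) = - 1" using dual by simp
    then show False by linarith
  qed
  moreover have "M \<noteq> 0"
  proof
    have "int d * int N > 0" using \<open>N \<noteq> 0\<close> d by simp
    assume "M = 0"
    then show False using rM \<open>int d * int N > 0\<close> by simp
  qed
  ultimately have "a \<noteq> 0" "b \<noteq> 0" using \<open>c \<noteq> 0\<close> by (simp_all add: a b)
  have order: "i \<ge> - int d * int (n div r)"
    if "has_symbol (E f) i n e" "e \<noteq> 0" "f \<in> range (dan_emb d P)" for f i n e
  proof -
    from has_symbol_unique_nonzero[OF that(1,2)]
    have "E f \<noteq> 0" and i: "i = fls_subdegree (lead_coeff (E f))" and n: "n = degree (E f)"
      by blast+
    have "degree P > 0" using P(2) by simp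
    from dan_emb_order[OF P(1) this E_range[OF that(3)] \<open>E f \<noteq> 0\<close>]
    show ?thesis unfolding i n r_def .
  qed
  have "r \<ge> 2" "int r * int M \<ge> int d * int N" using P(2) rM by (simp_all add: r_def)
  moreover have "1 + p \<ge> - int d * int (q div r)"
    using order[OF sym(1) \<open>a \<noteq> 0\<close> range_dan_emb(3)] by (simp add: add.commute)
  ultimately show False
    using order[OF sym(2) \<open>b \<noteq> 0\<close> range_dan_emb(4)] by (rule weight_arith[OF d _ dual])
qed

end

section \<open>Automorphisms\<close>

locale laurent_lnd_aut = laurent_lnd +
  fixes a :: "'a fls poly \<Rightarrow> 'a fls poly"
  assumes a_bij: "bij_betw a (range (dan_emb d P)) (range (dan_emb d P))"
    and a_add: "\<lbrakk>f \<in> range (dan_emb d P); g \<in> range (dan_emb d P)\<rbrakk> \<Longrightarrow> a (f + g) = a f + a g"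
    and a_mult: "\<lbrakk>f \<in> range (dan_emb d P); g \<in> range (dan_emb d P)\<rbrakk> \<Longrightarrow> a (f * g) = a f * a g"
    and a_const: "a [:fls_const c:] = [:fls_const c:]"
begin

abbreviation "R \<equiv> range (dan_emb d P)"

lemma a_range: "f \<in> R \<Longrightarrow> a f \<in> R"
  using a_bij by (auto simp: bij_betw_def)

lemma a_inj: "\<lbrakk>f \<in> R; g \<in> R; a f = a g\<rbrakk> \<Longrightarrow> f = g"
  using a_bij by (auto simp: bij_betw_def inj_on_def)

lemma a_zero: "a 0 = 0"
  using a_const[of 0] by simp

definition conjugate where
  "conjugate f = inv_into R a (E (a f))"

lemma conjugate_range: "f \<in> R \<Longrightarrow> conjugate f \<in> R"
  unfolding conjugate_def using a_bij by (metis E_range a_range bij_betw_def inv_into_into)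

lemma a_conjugate: "f \<in> R \<Longrightarrow> a (conjugate f) = E (a f)"
  unfolding conjugate_def using a_bij by (metis E_range a_range bij_betw_def f_inv_into_f)

text \<open>Each law is checked after applying the injective map \<open>a\<close>, where it becomes
  a law of \<open>E\<close>.\<close>

lemma laurent_lnd_conjugate: "laurent_lnd d P conjugate"
proof
  fix f g assume fg: "f \<in> R" "g \<in> R"
  note R = conjugate_range a_range
  have "a (conjugate (f + g)) = a (conjugate f + conjugate g)"
    using fg by (simp add: R a_conjugate a_add E_add)
  then show "conjugate (f + g) = conjugate f + conjugate g"
    by (rule a_inj[rotated 2]) (simp_all add: R fg)
  have "a (conjugate (f * g)) = a (conjugate f * g + f * conjugate g)"
    using fg by (simp add: R a_conjugate a_add a_mult E_mult)
  then show "conjugate (f * g) = conjugate f * g + f * conjugate g"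
    by (rule a_inj[rotated 2]) (simp_all add: R fg)
next
  fix c
  have "a (conjugate [:fls_const c:]) = a 0"
    by (simp add: a_conjugate a_const a_zero E_const)
  then show "conjugate [:fls_const c:] = 0"
    by (rule a_inj[rotated 2]) (simp_all add: conjugate_range)
next
  fix f assume f: "f \<in> R"
  have *: "(conjugate ^^ n) f \<in> R \<and> a ((conjugate ^^ n) f) = (E ^^ n) (a f)" for n
    using f by (induction n) (simp_all add: conjugate_range a_conjugate)
  obtain n where "(E ^^ n) (a f) = 0" using E_nilpotent[OF a_range[OF f]] by blast
  then have "a ((conjugate ^^ n) f) = a 0" using * a_zero by simp
  then have "(conjugate ^^ n) f = 0" by (rule a_inj[rotated 2]) (simp_all add: *)
  then show "\<exists>n. (conjugate ^^ n) f = 0" by blast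
qed (use d P conjugate_range in simp_all)

text \<open>The conjugate kills x by \<open>E_x\<close>, and \<open>a\<close> carries its value at x
  to \<open>E (a x)\<close>.\<close>

lemma E_a_x: "E (a [:fls_X:]) = 0"
  using laurent_lnd.E_x[OF laurent_lnd_conjugate] a_conjugate[OF range_dan_emb(3)] a_zero by simp

lemma twisted_commutator: "twisted_derivation d P a (\<lambda>f. E (a f) - a (E f))"
proof
  fix f g assume fg: "f \<in> R" "g \<in> R"
  note R = E_range a_range
  show "E (a (f + g)) - a (E (f + g)) = E (a f) - a (E f) + (E (a g) - a (E g))"
    using fg by (simp add: R a_add E_add)
  show "E (a (f * g)) - a (E (f * g)) = (E (a f) - a (E f)) * a g + a f * (E (a g) - a (E g))"
    using fg by (simp add: R a_mult a_add E_mult algebra_simps)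
next
  show "E (a [:fls_const c:]) - a (E [:fls_const c:]) = 0" for c
    by (simp add: a_const E_const a_zero)
  show "E (a [:fls_X:]) - a (E [:fls_X:]) = 0"
    by (simp add: E_a_x E_x a_zero)
  show "a [:fls_X:] \<noteq> 0"
    using a_inj[OF range_dan_emb(3) range_dan_emb(7)] a_zero by auto
qed (simp_all add: a_add a_mult)

lemma commute_iff:
  "E (a [:0, 1:]) = a (E [:0, 1:]) \<longleftrightarrow> E (a (y2_image d P)) = a (E (y2_image d P))"
  "E (a [:0, 1:]) = a (E [:0, 1:]) \<longleftrightarrow> (\<forall>f \<in> R. E (a f) = a (E f))"
proof -
  interpret twisted_derivation d P a "\<lambda>f. E (a f) - a (E f)" by (rule twisted_commutator)
  have "d > 0" using d by simp
  \<comment> \<open>P is not constant in Y_1 and the characteristic is zero, so the factor in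
    \<open>D_y2\<close> can be cancelled.\<close>
  have "laurent_emb (pderiv P) \<noteq> 0"
    using P by (simp add: pderiv_eq_0_iff)
  then have "a (laurent_emb (pderiv P)) \<noteq> 0"
    using a_inj[OF range_dan_emb(1) range_dan_emb(7), of "pderiv P"] a_zero by metis
  from D_y1_eq_0_iff[OF \<open>d > 0\<close> this]
  show "E (a [:0, 1:]) = a (E [:0, 1:]) \<longleftrightarrow> E (a (y2_image d P)) = a (E (y2_image d P))"
    by simp
  show "E (a [:0, 1:]) = a (E [:0, 1:]) \<longleftrightarrow> (\<forall>f \<in> R. E (a f) = a (E f))"
    using D_vanishes[OF \<open>d > 0\<close>] range_dan_emb(4) unfolding right_minus_eq by blast
qed

end

section \<open>Passage between the quotient algebra and its Laurent copy\<close>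

locale monic_dan =
  fixes d :: nat and P :: "'k::field_char_0 poly poly"
  assumes monic: "lead_coeff P = 1" and degree_pos: "degree P > 0"
begin

abbreviation "B \<equiv> dan_alg d P"

text \<open>The chosen representative is immaterial by \<open>dan_class_eq_iff_emb\<close>; likewise
  for the inverse \<open>of_laurent\<close>.\<close>

definition to_laurent where
  "to_laurent b = dan_emb d P (SOME F. dan_class d P F = b)"

definition of_laurent where
  "of_laurent f = dan_class d P (SOME F. dan_emb d P F = f)"

lemma dan_class_eq_iff_emb: "dan_class d P F = dan_class d P G \<longleftrightarrow> dan_emb d P F = dan_emb d P G"
  using dan_emb_eq_0_iff[OF monic degree_pos, of d "F - G"]
  by (simp add: dan_class_eq_iff dan_gen_def)

lemma to_laurent_class [simp]: "to_laurent (dan_class d P F) = dan_emb d P F"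
  unfolding to_laurent_def dan_class_eq_iff_emb[symmetric] by (rule someI[of _ F]) (rule refl)

lemma of_laurent_emb [simp]: "of_laurent (dan_emb d P F) = dan_class d P F"
  unfolding of_laurent_def dan_class_eq_iff_emb by (rule someI[of _ F]) (rule refl)

lemma carrier_B: "carrier B = range (dan_class d P)"
  by (auto simp: dan_alg_sel FactRing_def A_RCOSETS_def' dan_class_def ring_of_type_algebra_def)

lemma class_in_B [simp]: "dan_class d P F \<in> carrier B"
  by (simp add: carrier_B)

lemma class_ops [simp]:
  "dan_class d P F \<oplus>\<^bsub>B\<^esub> dan_class d P G = dan_class d P (F + G)"
  "dan_class d P F \<otimes>\<^bsub>B\<^esub> dan_class d P G = dan_class d P (F * G)"
  "c \<odot>\<^bsub>B\<^esub> dan_class d P F = dan_class d P ([:[:[:c:]:]:] * F)"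
  "\<zero>\<^bsub>B\<^esub> = dan_class d P 0" "\<one>\<^bsub>B\<^esub> = dan_class d P 1"
proof -
  note hom = dan_class_hom[of d P, unfolded ring_hom_def ring_of_type_algebra_def, simplified]
  interpret B: cring B by (rule cring_dan_alg)
  show add: "dan_class d P F \<oplus>\<^bsub>B\<^esub> dan_class d P G = dan_class d P (F + G)" for F G
    using hom by simp
  show mult: "dan_class d P F \<otimes>\<^bsub>B\<^esub> dan_class d P G = dan_class d P (F * G)" for F G
    using hom by simp
  show "c \<odot>\<^bsub>B\<^esub> dan_class d P F = dan_class d P ([:[:[:c:]:]:] * F)"
    unfolding dan_alg_sel(6) mult ..
  show "\<one>\<^bsub>B\<^esub> = dan_class d P 1" using hom by simp
  show "\<zero>\<^bsub>B\<^esub> = dan_class d P 0"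
  proof -
    obtain Z where Z: "\<zero>\<^bsub>B\<^esub> = dan_class d P Z" using B.zero_closed unfolding carrier_B by blast
    have "dan_class d P 0 = \<zero>\<^bsub>B\<^esub> \<oplus>\<^bsub>B\<^esub> dan_class d P 0" by (rule B.l_zero[OF class_in_B, symmetric])
    also have "\<dots> = \<zero>\<^bsub>B\<^esub>" unfolding Z add by simp
    finally show ?thesis by (rule sym)
  qed
qed

definition transfer where
  "transfer h f = to_laurent (h (of_laurent f))"

lemma to_of_laurent [simp]:
  "b \<in> carrier B \<Longrightarrow> of_laurent (to_laurent b) = b"
  "f \<in> range (dan_emb d P) \<Longrightarrow> to_laurent (of_laurent f) = f"
  by (auto simp: carrier_B)

lemma laurent_carrier [simp]:
  "b \<in> carrier B \<Longrightarrow> to_laurent b \<in> range (dan_emb d P)"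
  "f \<in> range (dan_emb d P) \<Longrightarrow> of_laurent f \<in> carrier B"
  by (auto simp: carrier_B)

lemma to_laurent_ops:
  "\<lbrakk>b \<in> carrier B; c \<in> carrier B\<rbrakk> \<Longrightarrow> to_laurent (b \<oplus>\<^bsub>B\<^esub> c) = to_laurent b + to_laurent c"
  "\<lbrakk>b \<in> carrier B; c \<in> carrier B\<rbrakk> \<Longrightarrow> to_laurent (b \<otimes>\<^bsub>B\<^esub> c) = to_laurent b * to_laurent c"
  "b \<in> carrier B \<Longrightarrow> to_laurent (k \<odot>\<^bsub>B\<^esub> b) = [:fls_const k:] * to_laurent b"
proof -
  assume b: "b \<in> carrier B"
  then obtain F where F: "b = dan_class d P F" unfolding carrier_B by blast
  show "to_laurent (k \<odot>\<^bsub>B\<^esub> b) = [:fls_const k:] * to_laurent b"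
    unfolding F class_ops to_laurent_class dan_emb_simps(4) dan_emb_vars(4) ..
qed (auto simp: carrier_B)

lemma of_laurent_ops:
  "\<lbrakk>f \<in> range (dan_emb d P); g \<in> range (dan_emb d P)\<rbrakk> \<Longrightarrow>
    of_laurent (f + g) = of_laurent f \<oplus>\<^bsub>B\<^esub> of_laurent g"
  "\<lbrakk>f \<in> range (dan_emb d P); g \<in> range (dan_emb d P)\<rbrakk> \<Longrightarrow>
    of_laurent (f * g) = of_laurent f \<otimes>\<^bsub>B\<^esub> of_laurent g"
  "f \<in> range (dan_emb d P) \<Longrightarrow> of_laurent ([:fls_const k:] * f) = k \<odot>\<^bsub>B\<^esub> of_laurent f"
proof -
  assume "f \<in> range (dan_emb d P)"
  then obtain F where F: "f = dan_emb d P F" by blast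
  show "of_laurent ([:fls_const k:] * f) = k \<odot>\<^bsub>B\<^esub> of_laurent f"
    unfolding F dan_emb_vars(4)[of d P k, symmetric] dan_emb_simps(4)[symmetric]
      of_laurent_emb class_ops ..
qed (auto simp flip: dan_emb_simps(3,4))

lemma to_laurent_inj: "\<lbrakk>b \<in> carrier B; c \<in> carrier B\<rbrakk> \<Longrightarrow> to_laurent b = to_laurent c \<longleftrightarrow> b = c"
  by (rule iffI, drule arg_cong[of _ _ of_laurent]) simp_all

lemma transfer_scale:
  assumes "\<And>b. b \<in> carrier B \<Longrightarrow> h b \<in> carrier B"
    and "\<And>b k. b \<in> carrier B \<Longrightarrow> h (k \<odot>\<^bsub>B\<^esub> b) = k \<odot>\<^bsub>B\<^esub> h b"
    and f: "f \<in> range (dan_emb d P)"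
  shows "transfer h ([:fls_const k:] * f) = [:fls_const k:] * transfer h f"
  unfolding transfer_def of_laurent_ops(3)[OF f] assms(2)[OF laurent_carrier(2)[OF f]]
    to_laurent_ops(3)[OF assms(1)[OF laurent_carrier(2)[OF f]]] ..

lemma laurent_lnd_transfer:
  assumes "\<delta> \<in> lnd B" "d \<ge> 2" "degree P \<ge> 2"
  shows "laurent_lnd d P (transfer \<delta>)"
proof -
  have \<delta>1: "\<delta> b \<in> carrier B" "\<delta> (k \<odot>\<^bsub>B\<^esub> b) = k \<odot>\<^bsub>B\<^esub> \<delta> b" "\<exists>n. (\<delta> ^^ n) b = \<zero>\<^bsub>B\<^esub>"
    if "b \<in> carrier B" for b k
    using assms(1) that unfolding lnd_def alg_der_def by auto
  have \<delta>2: "\<delta> (b \<oplus>\<^bsub>B\<^esub> c) = \<delta> b \<oplus>\<^bsub>B\<^esub> \<delta> c"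
    "\<delta> (b \<otimes>\<^bsub>B\<^esub> c) = (\<delta> b \<otimes>\<^bsub>B\<^esub> c) \<oplus>\<^bsub>B\<^esub> (b \<otimes>\<^bsub>B\<^esub> \<delta> c)"
    if "b \<in> carrier B" "c \<in> carrier B" for b c
    using assms(1) that unfolding lnd_def alg_der_def by auto
  note \<delta> = \<delta>1 \<delta>2
  interpret B: cring B by (rule cring_dan_alg)
  have mult: "transfer \<delta> (f * g) = transfer \<delta> f * g + f * transfer \<delta> g"
    if "f \<in> range (dan_emb d P)" "g \<in> range (dan_emb d P)" for f g
    using that by (simp add: transfer_def of_laurent_ops to_laurent_ops \<delta>)
  note scale = transfer_scale[of \<delta>, OF \<delta>1(1,2)]
  show ?thesis
  proof
    fix f g assume fg: "f \<in> range (dan_emb d P)" "g \<in> range (dan_emb d P)"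
    show "transfer \<delta> (f + g) = transfer \<delta> f + transfer \<delta> g"
      using fg by (simp add: transfer_def of_laurent_ops to_laurent_ops \<delta>)
    show "transfer \<delta> (f * g) = transfer \<delta> f * g + f * transfer \<delta> g"
      using fg by (rule mult)
  next
    fix c
    have "1 \<in> range (dan_emb d P)" by (metis dan_emb_simps(2) rangeI)
    \<comment> \<open>The Leibniz rule for 1 = 1 * 1 kills 1, and linearity extends this to all
      constants.\<close>
    moreover from mult[OF this this] have "transfer \<delta> 1 = 0" by simp
    ultimately show "transfer \<delta> [:fls_const c:] = 0" using scale[of 1 c] by simp
  next
    fix f assume f: "f \<in> range (dan_emb d P)"
    then show "transfer \<delta> f \<in> range (dan_emb d P)" by (simp add: transfer_def \<delta>)
    have *: "(\<delta> ^^ n) (of_laurent f) \<in> carrier B \<and>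
        (transfer \<delta> ^^ n) f = to_laurent ((\<delta> ^^ n) (of_laurent f))" for n
      using f by (induction n) (simp_all add: transfer_def \<delta>)
    obtain n where "(\<delta> ^^ n) (of_laurent f) = \<zero>\<^bsub>B\<^esub>" using \<delta>1(3) f laurent_carrier(2) by blast
    then show "\<exists>n. (transfer \<delta> ^^ n) f = 0" using * by (intro exI[of _ n]) simp
  qed (use assms monic in simp_all)
qed

lemma laurent_lnd_aut_transfer:
  assumes "\<delta> \<in> lnd B" "\<alpha> \<in> alg_aut B" "d \<ge> 2" "degree P \<ge> 2"
  shows "laurent_lnd_aut d P (transfer \<delta>) (transfer \<alpha>)"
proof -
  interpret laurent_lnd d P "transfer \<delta>" using laurent_lnd_transfer[OF assms(1,3,4)] .
  have \<alpha>_lin: "\<alpha> b \<in> carrier B" "\<alpha> (k \<odot>\<^bsub>B\<^esub> b) = k \<odot>\<^bsub>B\<^esub> \<alpha> b" if "b \<in> carrier B" for b k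
    using assms(2) that unfolding alg_aut_def ring_iso_def ring_hom_def by auto
  have \<alpha>: "\<alpha> (b \<oplus>\<^bsub>B\<^esub> c) = \<alpha> b \<oplus>\<^bsub>B\<^esub> \<alpha> c"
    "\<alpha> (b \<otimes>\<^bsub>B\<^esub> c) = \<alpha> b \<otimes>\<^bsub>B\<^esub> \<alpha> c"
    if "b \<in> carrier B" "c \<in> carrier B" for b c
    using assms(2) that unfolding alg_aut_def ring_iso_def ring_hom_def by auto
  have \<alpha>1: "\<alpha> \<one>\<^bsub>B\<^esub> = \<one>\<^bsub>B\<^esub>" and bij: "bij_betw \<alpha> (carrier B) (carrier B)"
    using assms(2) unfolding alg_aut_def ring_iso_def ring_hom_def by auto
  have bij1: "bij_betw of_laurent (range (dan_emb d P)) (carrier B)"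
    by (rule bij_betw_byWitness[of _ to_laurent]) auto
  have bij2: "bij_betw to_laurent (carrier B) (range (dan_emb d P))"
    by (rule bij_betw_byWitness[of _ of_laurent]) auto
  have "transfer \<alpha> = to_laurent \<circ> (\<alpha> \<circ> of_laurent)" by (simp add: transfer_def fun_eq_iff)
  then have "bij_betw (transfer \<alpha>) (range (dan_emb d P)) (range (dan_emb d P))"
    using bij_betw_trans[OF bij_betw_trans[OF bij1 bij] bij2] by simp
  moreover have "transfer \<alpha> (f + g) = transfer \<alpha> f + transfer \<alpha> g"
    "transfer \<alpha> (f * g) = transfer \<alpha> f * transfer \<alpha> g"
    if "f \<in> range (dan_emb d P)" "g \<in> range (dan_emb d P)" for f g
    using that by (simp_all add: transfer_def of_laurent_ops to_laurent_ops \<alpha> \<alpha>_lin)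
  moreover have "transfer \<alpha> [:fls_const c:] = [:fls_const c:]" for c
  proof -
    have 1: "1 \<in> range (dan_emb d P)" by (metis dan_emb_simps(2) rangeI)
    have "of_laurent 1 = \<one>\<^bsub>B\<^esub>" using of_laurent_emb[of 1] by simp
    then have "transfer \<alpha> 1 = 1" using \<alpha>1 by (simp add: transfer_def)
    then show ?thesis using transfer_scale[of \<alpha>, OF \<alpha>_lin 1, of c] by simp
  qed
  ultimately show ?thesis by unfold_locales
qed

lemma transfer_commute_iff:
  assumes "\<delta> \<in> lnd B" "\<alpha> \<in> alg_aut B"
  shows "transfer \<delta> (transfer \<alpha> (dan_emb d P F)) = transfer \<alpha> (transfer \<delta> (dan_emb d P F)) \<longleftrightarrow>
    \<delta> (\<alpha> (dan_class d P F)) = \<alpha> (\<delta> (dan_class d P F))"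
proof -
  have "\<delta> b \<in> carrier B" "\<alpha> b \<in> carrier B" if "b \<in> carrier B" for b
    using assms that unfolding lnd_def alg_der_def alg_aut_def ring_iso_def ring_hom_def by auto
  then show ?thesis by (simp add: transfer_def to_laurent_inj)
qed

end

lemma std_poly_monic:
  fixes s :: "nat \<Rightarrow> 'k::field_char_0 poly"
  shows "lead_coeff (std_poly r s) = 1" "degree (std_poly r s) = r"
  by (simp only: std_poly_def lead_coeff_prod, simp) (simp add: std_poly_def degree_prod_sum_eq)

theorem lemma4p4:
  fixes d r :: nat
    and s :: "nat \<Rightarrow> 'k::field_char_0 poly"
    and P :: "'k poly poly"
    and \<delta> \<alpha> :: "'k poly poly poly set \<Rightarrow> 'k poly poly poly set"
  assumes "d \<ge> 2"
    and "r \<ge> 2"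
    and "P = std_poly r s"
    and "\<delta> \<in> lnd (dan_alg d P)"
    and "\<alpha> \<in> alg_aut (dan_alg d P)"
  shows "(\<alpha> \<in> der_aut (dan_alg d P) \<delta> \<longleftrightarrow>
            \<delta> (\<alpha> (dan_y1 d P)) = \<alpha> (\<delta> (dan_y1 d P))) \<and>
         (\<delta> (\<alpha> (dan_y1 d P)) = \<alpha> (\<delta> (dan_y1 d P)) \<longleftrightarrow>
            \<delta> (\<alpha> (dan_y2 d P)) = \<alpha> (\<delta> (dan_y2 d P)))"
proof -
  have P: "lead_coeff P = 1" "degree P = r" using assms(3) std_poly_monic by simp_all
  interpret monic_dan d P using P assms(2) by unfold_locales simp_all
  interpret laurent_lnd_aut d P "transfer \<delta>" "transfer \<alpha>"
    using laurent_lnd_aut_transfer[OF assms(4,5,1)] P assms(2) by simp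
  note iff = transfer_commute_iff[OF assms(4,5)]
  have y1: "\<delta> (\<alpha> (dan_y1 d P)) = \<alpha> (\<delta> (dan_y1 d P)) \<longleftrightarrow>
      transfer \<delta> (transfer \<alpha> [:0, 1:]) = transfer \<alpha> (transfer \<delta> [:0, 1:])"
    using iff[of var_Y1] by (simp only: dan_emb_vars dan_y1_def)
  have y2: "\<delta> (\<alpha> (dan_y2 d P)) = \<alpha> (\<delta> (dan_y2 d P)) \<longleftrightarrow>
      transfer \<delta> (transfer \<alpha> (y2_image d P)) = transfer \<alpha> (transfer \<delta> (y2_image d P))"
    using iff[of var_Y2] by (simp only: dan_emb_vars dan_y2_def)
  \<comment> \<open>Every element of B is a class, so membership means commuting on the whole range,
    which \<open>commute_iff\<close> reduces to y_1.\<close>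
  have "\<alpha> \<in> der_aut B \<delta> \<longleftrightarrow> (\<forall>F. \<delta> (\<alpha> (dan_class d P F)) = \<alpha> (\<delta> (dan_class d P F)))"
    using assms(5) unfolding der_aut_def carrier_B by auto
  also have "\<dots> \<longleftrightarrow> (\<forall>f \<in> range (dan_emb d P).
      transfer \<delta> (transfer \<alpha> f) = transfer \<alpha> (transfer \<delta> f))"
    by (simp add: iff)
  finally show ?thesis using commute_iff y1 y2 by simp
qed

end
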